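(* Let $h_d,h_{b,u},h_{b,d_1},h_{b,d_2},h_{d_1,u},h_{d_2,u},\eta_1,\eta_2>0$ and let $P_1,P_2,P_u>0$ (all real numbers). (HD) If $P_u h_{d_2,u}>P_1h_d$ and $P_1h_{b,d_1}>P_uh_{b,u}$ (power multiplexing conditions of the first half-time slot), then the half-duplex SIC condition $h_{b,d_1}h_{d_2,u}>h_dh_{b,u}$ holds. Likewise, if $P_uh_{d_1,u}>P_2h_d$ and $P_2h_{b,d_2}>P_uh_{b,u}$ (second half-time slot), then $h_{d_1,u}h_{b,d_2}>h_{b,u}h_d$. (FD, first decoding order) If $$P_2h_{b,d_2}>P_1h_{b,d_1}+P_uh_{b,u},\quad P_uh_{d_1,u}>P_2h_d+P_1\eta_1,\quad P_1h_{b,d_1}>P_uh_{b,u},\quad P_uh_{d_2,u}>P_1h_d+P_2\eta_2,$$ then all four SIC rate conditions hold: $$P_1(h_{b,d_2}\eta_1-h_dh_{b,d_1})+P_u(h_{d_1,u}h_{b,d_2}-h_dh_{b,u})>0,$$ $$P_1(h_{d_1,u}h_{b,d_1}-h_{b,u}\eta_1)+P_2(h_{d_1,u}h_{b,d_2}-h_{b,u}h_d)>0,$$ $$P_2h_{b,d_1}\eta_2>P_u(h_{b,u}h_d-h_{d_2,u}h_{b,d_1}),$$ $$P_1(h_{b,d_1}h_{d_2,u}-h_dh_{b,u})>P_2\eta_2h_{b,u}.$$ (FD, second decoding order) If $$P_2h_{b,d_2}>P_uh_{b,u},\quad P_uh_{d_1,u}>P_2h_d+P_1\eta_1,\quad P_1h_{b,d_1}>P_uh_{b,u}+P_2h_{b,d_2},\quad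 P_uh_{d_2,u}>P_1h_d+P_2\eta_2,$$ then all four SIC rate conditions hold: $$P_1\eta_1h_{b,d_2}>P_u(h_{b,u}h_d-h_{b,d_2}h_{d_1,u}),$$ $$P_2(h_{d_1,u}h_{b,d_2}-h_{b,u}h_d)>h_{b,u}\eta_1P_1,$$ $$P_2(h_{b,d_1}\eta_2-h_{b,d_2}h_d)+P_u(h_{b,d_1}h_{d_2,u}-h_{b,u}h_d)>0,$$ $$P_1(h_{d_2,u}h_{b,d_1}-h_dh_{b,u})+P_2(h_{b,d_2}h_{d_2,u}-h_{b,u}\eta_2)>0.$$ Moreover, under the power multiplexing conditions of either FD decoding order, the following four channel conditions necessarily hold: $$h_{b,d_1}h_{d_2,u}>h_dh_{b,u},\quad h_{d_1,u}h_{b,d_2}>h_{b,u}h_d,\quad h_{b,d_1}h_{d_1,u}>\eta_1h_{b,u},\quad h_{b,d_2}h_{d_2,u}>\eta_2h_{b,u}.$$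
   Context: A cellular user $u$ transmits with power $P_u$ to a base station $b$, sharing its channel with two D2D devices $d_1,d_2$ communicating with each other with transmit powers $P_1,P_2$. $h_d$ is the $d_1$–$d_2$ channel gain; $h_{b,u},h_{b,d_1},h_{b,d_2}$ are the gains from $u,d_1,d_2$ to $b$; $h_{d_1,u},h_{d_2,u}$ are the gains from $u$ to $d_1,d_2$; $\eta_1,\eta_2$ are self-interference factors in full-duplex (FD) mode. In half-duplex (HD) mode, only $d_1$ (first half-slot) or only $d_2$ (second half-slot) transmits. Mutual SIC means that $b$ decodes and removes the D2D messages while $d_1,d_2$ decode and remove the message of $u$. In FD, the first (second) decoding order means that $b$ decodes the message of $d_2$ before that of $d_1$ (of $d_1$ before that of $d_2$). The SIC rate conditions are the SINR inequalities needed for decoding, with noise neglected relative to interference; the power multiplexing conditions say that the message being decoded dominates the sum of the remaining signals. *)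

theory Defs
  imports Complex_Main
begin

end

(*
  Every power multiplexing condition has the form ``decoded signal exceeds interference''. If
  S > p c at one receiver and p g > I at the other, with the same power p, then
  g S > g p c > c I; eliminating a power in this way from suitable pairs of conditions gives all
  the SIC rate conditions, and the channel conditions after cancelling the other power as well.
  The two full-duplex orders are exchanged by swapping the indices 1 and 2.
*)

theory Submission
  imports Defs
begin

lemma eliminate_power:
  fixes S I p c g :: real
  assumes "S > p * c" and "p * g > I" and "c > 0" and "g > 0"
  shows "g * S > c * I"
proof -
  have "g * S > g * (p * c)"
    using assms by simp
  moreover have "c * (p * g) > c * I"
    using assms by simp
  ultimately show ?thesis
    by (simp add: mult_ac)
qed

text \<open>Here the signal at the first receiver and the interference at the second carry the same
  power \<open>q\<close>, so after \<open>p\<close> is eliminated \<open>q\<close> cancels and only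
  gains remain.\<close>

lemma channel_gain_product_less:
  fixes p q g h k c :: real
  assumes "q * h > p * c" and "p * g > q * k" and "c > 0" and "g > 0" and "q > 0"
  shows "h * g > k * c"
proof -
  have "q * (h * g) > q * (k * c)"
    using eliminate_power [OF assms(1-4)] by (simp add: mult_ac)
  with \<open>q > 0\<close> show ?thesis
    by simp
qed

text \<open>Stated for the first decoding order, with rate and channel conditions together, so that
  one exchange of the device indices yields the second order.\<close>

lemma full_duplex_sic:
  fixes h_d h_bu h_bd1 h_bd2 h_d1u h_d2u \<eta>1 \<eta>2 P1 P2 Pu :: real
  assumes pos: "h_d > 0" "h_bu > 0" "h_bd1 > 0" "h_bd2 > 0" "h_d1u > 0" "h_d2u > 0"
      "\<eta>1 > 0" "\<eta>2 > 0" "P1 > 0" "P2 > 0" "Pu > 0"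
    and b2: "P2 * h_bd2 > P1 * h_bd1 + Pu * h_bu"
    and d1: "Pu * h_d1u > P2 * h_d + P1 * \<eta>1"
    and b1: "P1 * h_bd1 > Pu * h_bu"
    and d2: "Pu * h_d2u > P1 * h_d + P2 * \<eta>2"
  shows "P1 * (h_bd2 * \<eta>1 - h_d * h_bd1) + Pu * (h_d1u * h_bd2 - h_d * h_bu) > 0"
    and "P1 * (h_d1u * h_bd1 - h_bu * \<eta>1) + P2 * (h_d1u * h_bd2 - h_bu * h_d) > 0"
    and "P2 * h_bd1 * \<eta>2 > Pu * (h_bu * h_d - h_d2u * h_bd1)"
    and "P1 * (h_bd1 * h_d2u - h_d * h_bu) > P2 * \<eta>2 * h_bu"
    and "h_bd1 * h_d2u > h_d * h_bu"
    and "h_d1u * h_bd2 > h_bu * h_d"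
    and "h_bd1 * h_d1u > \<eta>1 * h_bu"
    and "h_bd2 * h_d2u > \<eta>2 * h_bu"
proof -
  have prod: "P1 * h_bd1 > 0" "P2 * h_d > 0" "P1 * \<eta>1 > 0" "P1 * h_d > 0" "P2 * \<eta>2 > 0"
    using pos by simp_all
  \<comment> \<open>Dropping all but one positive interference term leaves comparisons of two single
    signals, the form that permits cancelling both powers.\<close>
  have b2': "P2 * h_bd2 > Pu * h_bu" and d1_h: "Pu * h_d1u > P2 * h_d"
    and d1_\<eta>: "Pu * h_d1u > P1 * \<eta>1" and d2_h: "Pu * h_d2u > P1 * h_d"
    and d2_\<eta>: "Pu * h_d2u > P2 * \<eta>2"
    using b2 d1 d2 prod by linarith+
  \<comment> \<open>The second rate condition counts both D2D signals at the base station as useful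
    against that of the cellular user.\<close>
  have sum: "P1 * h_bd1 + P2 * h_bd2 > Pu * h_bu"
    using b2' prod by linarith
  have pos': "P1 * (h_bd2 * \<eta>1) > 0" "P2 * (h_bd1 * \<eta>2) > 0"
    using pos by simp_all
  \<comment> \<open>Eliminating \<open>P2\<close> proves this even without the positive
    self-interference term \<open>P1 * (h_bd2 * \<eta>1)\<close>.\<close>
  show "P1 * (h_bd2 * \<eta>1 - h_d * h_bd1) + Pu * (h_d1u * h_bd2 - h_d * h_bu) > 0"
    using eliminate_power [OF d1_h b2 pos(1,4)] pos'
    by (simp only: algebra_simps)
  show "P1 * (h_d1u * h_bd1 - h_bu * \<eta>1) + P2 * (h_d1u * h_bd2 - h_bu * h_d) > 0"
    using eliminate_power [OF sum d1] pos by (simp add: algebra_simps)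
  \<comment> \<open>Eliminating \<open>P1\<close> makes the right side negative, while the left side
    is positive.\<close>
  show "P2 * h_bd1 * \<eta>2 > Pu * (h_bu * h_d - h_d2u * h_bd1)"
    using eliminate_power [OF d2_h b1 pos(1,3)] pos'
    by (simp only: algebra_simps)
  show "P1 * (h_bd1 * h_d2u - h_d * h_bu) > P2 * \<eta>2 * h_bu"
    using eliminate_power [OF b1 d2] pos by (simp add: algebra_simps)
  show "h_bd1 * h_d2u > h_d * h_bu"
    using channel_gain_product_less [OF b1 d2_h] pos by simp
  show "h_d1u * h_bd2 > h_bu * h_d"
    using channel_gain_product_less [OF b2' d1_h] pos by (simp add: mult.commute)
  show "h_bd1 * h_d1u > \<eta>1 * h_bu"
    using channel_gain_product_less [OF b1 d1_\<eta>] pos by simp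
  show "h_bd2 * h_d2u > \<eta>2 * h_bu"
    using channel_gain_product_less [OF b2' d2_\<eta>] pos by simp
qed

theorem mainTheorem1:
  fixes h_d h_bu h_bd1 h_bd2 h_d1u h_d2u \<eta>1 \<eta>2 P1 P2 Pu :: real
  assumes "h_d > 0" and "h_bu > 0" and "h_bd1 > 0" and "h_bd2 > 0"
    and "h_d1u > 0" and "h_d2u > 0" and "\<eta>1 > 0" and "\<eta>2 > 0"
    and "P1 > 0" and "P2 > 0" and "Pu > 0"
  shows
    "\<comment> \<open>half-duplex, first and second half-time slot\<close>
    ((Pu * h_d2u > P1 * h_d \<and> P1 * h_bd1 > Pu * h_bu
         \<longrightarrow> h_bd1 * h_d2u > h_d * h_bu)
    \<and> (Pu * h_d1u > P2 * h_d \<and> P2 * h_bd2 > Pu * h_bu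
         \<longrightarrow> h_d1u * h_bd2 > h_bu * h_d))
     \<and> \<comment> \<open>full-duplex, first decoding order\<close>
    (P2 * h_bd2 > P1 * h_bd1 + Pu * h_bu
       \<and> Pu * h_d1u > P2 * h_d + P1 * \<eta>1
       \<and> P1 * h_bd1 > Pu * h_bu
       \<and> Pu * h_d2u > P1 * h_d + P2 * \<eta>2
      \<longrightarrow> P1 * (h_bd2 * \<eta>1 - h_d * h_bd1) + Pu * (h_d1u * h_bd2 - h_d * h_bu) > 0
       \<and> P1 * (h_d1u * h_bd1 - h_bu * \<eta>1) + P2 * (h_d1u * h_bd2 - h_bu * h_d) > 0
       \<and> P2 * h_bd1 * \<eta>2 > Pu * (h_bu * h_d - h_d2u * h_bd1)
       \<and> P1 * (h_bd1 * h_d2u - h_d * h_bu) > P2 * \<eta>2 * h_bu)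
     \<and> \<comment> \<open>full-duplex, second decoding order\<close>
    (P2 * h_bd2 > Pu * h_bu
       \<and> Pu * h_d1u > P2 * h_d + P1 * \<eta>1
       \<and> P1 * h_bd1 > Pu * h_bu + P2 * h_bd2
       \<and> Pu * h_d2u > P1 * h_d + P2 * \<eta>2
      \<longrightarrow> P1 * \<eta>1 * h_bd2 > Pu * (h_bu * h_d - h_bd2 * h_d1u)
       \<and> P2 * (h_d1u * h_bd2 - h_bu * h_d) > h_bu * \<eta>1 * P1
       \<and> P2 * (h_bd1 * \<eta>2 - h_bd2 * h_d) + Pu * (h_bd1 * h_d2u - h_bu * h_d) > 0
       \<and> P1 * (h_d2u * h_bd1 - h_d * h_bu) + P2 * (h_bd2 * h_d2u - h_bu * \<eta>2) > 0)
     \<and> \<comment> \<open>channel conditions forced by either full-duplex decoding order\<close>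
    ((P2 * h_bd2 > P1 * h_bd1 + Pu * h_bu
        \<and> Pu * h_d1u > P2 * h_d + P1 * \<eta>1
        \<and> P1 * h_bd1 > Pu * h_bu
        \<and> Pu * h_d2u > P1 * h_d + P2 * \<eta>2)
      \<or> (P2 * h_bd2 > Pu * h_bu
        \<and> Pu * h_d1u > P2 * h_d + P1 * \<eta>1
        \<and> P1 * h_bd1 > Pu * h_bu + P2 * h_bd2
        \<and> Pu * h_d2u > P1 * h_d + P2 * \<eta>2)
      \<longrightarrow> h_bd1 * h_d2u > h_d * h_bu
       \<and> h_d1u * h_bd2 > h_bu * h_d
       \<and> h_bd1 * h_d1u > \<eta>1 * h_bu
       \<and> h_bd2 * h_d2u > \<eta>2 * h_bu)"
  (is "?HD \<and> ?FD1 \<and> (?M2 \<longrightarrow> ?R2) \<and> (?M1 \<or> _ \<longrightarrow> ?C)")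
proof (intro conjI)
  \<comment> \<open>In each half-slot \<open>Pu\<close> is eliminated between the base station and
    the listening device; the power of the transmitting device then cancels.\<close>
  show "Pu * h_d2u > P1 * h_d \<and> P1 * h_bd1 > Pu * h_bu \<longrightarrow> h_bd1 * h_d2u > h_d * h_bu"
    using channel_gain_product_less [of Pu h_bu P1 h_bd1 h_d h_d2u] assms by blast
  show "Pu * h_d1u > P2 * h_d \<and> P2 * h_bd2 > Pu * h_bu \<longrightarrow> h_d1u * h_bd2 > h_bu * h_d"
    using channel_gain_product_less [of Pu h_bu P2 h_bd2 h_d h_d1u] assms
    by (simp add: mult.commute)
next
  note first = full_duplex_sic [OF assms]
  note second = full_duplex_sic
    [of h_d h_bu h_bd2 h_bd1 h_d2u h_d1u \<eta>2 \<eta>1 P2 P1 Pu,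
     OF assms(1,2,4,3,6,5,8,7,10,9,11)]
  show ?FD1
    using first(1-4) by blast
  show "?M2 \<longrightarrow> ?R2"
  proof (intro impI, elim conjE)
    assume "P2 * h_bd2 > Pu * h_bu" "Pu * h_d1u > P2 * h_d + P1 * \<eta>1"
      "P1 * h_bd1 > Pu * h_bu + P2 * h_bd2" "Pu * h_d2u > P1 * h_d + P2 * \<eta>2"
    \<comment> \<open>The index swap returns the rate conditions with the first two and the last two
      exchanged.\<close>
    then show ?R2
      using second(1-4) by (simp add: algebra_simps)
  qed
  show "?M1 \<or> ?M2 \<longrightarrow> ?C"
  proof (intro impI, elim disjE conjE)
    assume "P2 * h_bd2 > P1 * h_bd1 + Pu * h_bu" "Pu * h_d1u > P2 * h_d + P1 * \<eta>1"
      "P1 * h_bd1 > Pu * h_bu" "Pu * h_d2u > P1 * h_d + P2 * \<eta>2"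
    then show ?C
      using first(5-8) by blast
  next
    assume "P2 * h_bd2 > Pu * h_bu" "Pu * h_d1u > P2 * h_d + P1 * \<eta>1"
      "P1 * h_bd1 > Pu * h_bu + P2 * h_bd2" "Pu * h_d2u > P1 * h_d + P2 * \<eta>2"
    \<comment> \<open>The swap only permutes the four channel conditions, so both orders force the
      same ones.\<close>
    then show ?C
      using second(5-8) by (simp add: mult.commute add.commute)
  qed
qed

end
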